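(* Let $A(n)$ and $B(n)$ satisfy the following relationship: $$\sum_{n=0}^\infty A(n)\,P_n(v,u)=\sum_{n=0}^\infty B(n)\,\frac{(xutq^{1-n};q)_\infty}{(xvtq^{1-n};q)_\infty}.\qquad(1)$$ Then $$\sum_{n=0}^\infty(-1)^nq^{\binom n2}A(n)\,\Psi_n^{(\mathbf a,\mathbf b)}(u,v,z|q)=\sum_{n=0}^\infty B(n)\,\frac{(xutq^{1-n};q)_\infty}{(xvtq^{1-n};q)_\infty}\;{}_r\Phi_s\left[\begin{matrix}a_1,\dots,a_r\\ b_1,\dots,b_s\end{matrix};q;xztq^{1-n}\right],\qquad(2)$$ provided that each of the series in (1) and (2) is absolutely convergent.
   Context: Throughout, $|q|<1$. The $q$-shifted factorials are $(a;q)_0=1$, $(a;q)_n=\prod_{i=0}^{n-1}(1-aq^i)$, $(a;q)_\infty=\prod_{i=0}^\infty(1-aq^i)$, and $(c_1,\dots,c_m;q)_n=(c_1;q)_n\cdots(c_m;q)_n$. The $q$-binomial coefficient is $\begin{bmatrix}n\\k\end{bmatrix}_q=\frac{(q;q)_n}{(q;q)_k(q;q)_{n-k}}$. Let $\mathbf a=(a_1,\dots,a_r)$, $\mathbf b=(b_1,\dots,b_s)$, and $W_k(\mathbf a,\mathbf b)=\frac{(a_1,\dots,a_r;q)_k}{(b_1,\dots,b_s;q)_k}$. The basic hypergeometric series is $${}_r\Phi_s\left[\begin{matrix}a_1,\dots,a_r\\ b_1,\dots,b_s\end{matrix};q;z\right]=\sum_{k=0}^\infty W_k(\mathbf a,\mathbf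 b)\left[(-1)^kq^{\binom k2}\right]^{1+s-r}\frac{z^k}{(q;q)_k}.$$ Cauchy polynomials: $P_n(x,y)=(x-y)(x-qy)\cdots(x-q^{n-1}y)$, with $P_0(x,y)=1$. Generalized $q$-hypergeometric polynomials: $$\Psi_n^{(\mathbf a,\mathbf b)}(x,y,z|q)=(-1)^nq^{-\binom n2}\sum_{k=0}^n\begin{bmatrix}n\\k\end{bmatrix}_q\left[(-1)^kq^{\binom k2}\right]^{1+s-r}W_k(\mathbf a,\mathbf b)\,P_{n-k}(y,x)\,z^k.$$ *)

theory Defs
  imports "HOL-Analysis.Analysis"
begin

definition qpoch :: "complex \<Rightarrow> complex \<Rightarrow> nat \<Rightarrow> complex" where
  "qpoch a q n = (\<Prod>i<n. 1 - a * q ^ i)"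

definition qpoch_inf :: "complex \<Rightarrow> complex \<Rightarrow> complex" where
  "qpoch_inf a q = (\<Prod>i. 1 - a * q ^ i)"

definition qpochs :: "complex list \<Rightarrow> complex \<Rightarrow> nat \<Rightarrow> complex" where
  "qpochs cs q n = (\<Prod>c\<leftarrow>cs. qpoch c q n)"

text \<open>Used only for \<open>k \<le> n\<close>.\<close>

definition qbinom :: "complex \<Rightarrow> nat \<Rightarrow> nat \<Rightarrow> complex" where
  "qbinom q n k = qpoch q q n / (qpoch q q k * qpoch q q (n - k))"

definition W :: "complex list \<Rightarrow> complex list \<Rightarrow> complex \<Rightarrow> nat \<Rightarrow> complex" where
  "W a b q k = qpochs a q k / qpochs b q k"

text \<open>
  The factor \<open>[(-1)^k q^(k choose 2)]^(1 + s - r)\<close>, where \<open>r\<close> and \<open>s\<close> are the lengths of the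
  two parameter lists. The outer exponent is an integer that may be negative.
\<close>

definition sgn_factor :: "complex list \<Rightarrow> complex list \<Rightarrow> complex \<Rightarrow> nat \<Rightarrow> complex" where
  "sgn_factor a b q k =
     ((-1) ^ k * q ^ (k choose 2)) powi (1 + int (length b) - int (length a))"

definition Phi_term ::
  "complex list \<Rightarrow> complex list \<Rightarrow> complex \<Rightarrow> complex \<Rightarrow> nat \<Rightarrow> complex" where
  "Phi_term a b q z k = W a b q k * sgn_factor a b q k * z ^ k / qpoch q q k"

definition Phi :: "complex list \<Rightarrow> complex list \<Rightarrow> complex \<Rightarrow> complex \<Rightarrow> complex" where
  "Phi a b q z = (\<Sum>k. Phi_term a b q z k)"

definition cauchy_poly :: "complex \<Rightarrow> nat \<Rightarrow> complex \<Rightarrow> complex \<Rightarrow> complex" where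
  "cauchy_poly q n x y = (\<Prod>i<n. x - q ^ i * y)"

definition Psi ::
  "complex list \<Rightarrow> complex list \<Rightarrow> complex \<Rightarrow> nat \<Rightarrow> complex \<Rightarrow> complex \<Rightarrow> complex \<Rightarrow> complex" where
  "Psi a b q n x y z =
     (-1) ^ n * q powi (- int (n choose 2)) *
     (\<Sum>k\<le>n. qbinom q n k * sgn_factor a b q k * W a b q k * cauchy_poly q (n - k) y x * z ^ k)"

definition qratio ::
  "complex \<Rightarrow> complex \<Rightarrow> complex \<Rightarrow> complex \<Rightarrow> complex \<Rightarrow> nat \<Rightarrow> complex" where
  "qratio q x t u v n =
     qpoch_inf (x * u * t * q powi (1 - int n)) q / qpoch_inf (x * v * t * q powi (1 - int n)) q"

text \<open>
  Both sides of the relation between \<open>A\<close> and \<open>B\<close> are meaningful at the point \<open>(u, v)\<close>: no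
  denominator that actually occurs vanishes (a term with \<open>B n = 0\<close> is regarded as absent), and
  both series converge absolutely.
\<close>

definition relation_converges ::
  "complex \<Rightarrow> complex \<Rightarrow> complex \<Rightarrow> (nat \<Rightarrow> complex) \<Rightarrow> (nat \<Rightarrow> complex) \<Rightarrow>
   complex \<Rightarrow> complex \<Rightarrow> bool" where
  "relation_converges q x t A B u v \<longleftrightarrow>
     (\<forall>n. B n \<noteq> 0 \<longrightarrow> qpoch_inf (x * v * t * q powi (1 - int n)) q \<noteq> 0) \<and>
     summable (\<lambda>n. norm (A n * cauchy_poly q n v u)) \<and>
     summable (\<lambda>n. norm (B n * qratio q x t u v n))"

text \<open>
  Absolute convergence of the series in the conclusion: the outer series on each side, and the
  basic hypergeometric series in every term that is present.
\<close>

definition conclusion_converges ::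
  "complex list \<Rightarrow> complex list \<Rightarrow> complex \<Rightarrow> complex \<Rightarrow> complex \<Rightarrow>
   (nat \<Rightarrow> complex) \<Rightarrow> (nat \<Rightarrow> complex) \<Rightarrow> complex \<Rightarrow> complex \<Rightarrow> complex \<Rightarrow> bool" where
  "conclusion_converges a b q x t A B u v z \<longleftrightarrow>
     summable (\<lambda>n. norm ((-1) ^ n * q ^ (n choose 2) * A n * Psi a b q n u v z)) \<and>
     (\<forall>n. B n \<noteq> 0 \<longrightarrow>
        summable (\<lambda>k. norm (Phi_term a b q (x * z * t * q powi (1 - int n)) k))) \<and>
     summable (\<lambda>n. norm (B n * qratio q x t u v n * Phi a b q (x * z * t * q powi (1 - int n))))"

end

theory Submission imports Defs "HOL-Complex_Analysis.Complex_Analysis" begin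

text \<open>
  Write \<open>y n = x t q^(1 - n)\<close>. Absolute convergence of the double series in the conclusion is not
  given, so a \<open>q\<close>-difference operator cannot be applied term by term. But the relation on an open set
  is rigid: for \<open>x t \<noteq> 0\<close> only finitely many \<open>B n\<close> are nonzero. Indeed the identity theorem extends
  the relation, for fixed \<open>v\<close>, to all small \<open>u\<close>. At \<open>u = 1 / y (m + 1)\<close> all terms with \<open>n > m\<close>
  vanish, and after multiplication by \<open>(y m v; q)_\<infinity>\<close> the right-hand side is a polynomial in \<open>v\<close>;
  continuing to \<open>v = 1 / y m\<close> makes the left-hand side 0 and leaves a nonzero multiple of \<open>B m\<close> on
  the right.

  Setting \<open>u = 0\<close> gives \<open>A k (q; q)_k = (\<Sum>n. B n (y n)^k)\<close>, a finite sum dominated by its term with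
  largest \<open>n\<close>. Hence absolute convergence of \<open>\<Sum>A k P_k(v, u)\<close> implies that of each
  \<open>\<Sum>(y n)^k P_k(v, u) / (q; q)_k\<close>, whose sum is given by the \<open>q\<close>-binomial theorem, and the claim is a
  finite combination of Cauchy products. For \<open>x t = 0\<close> all ratios in the relation are 1.
\<close>

section \<open>Finite q-shifted factorials and Cauchy polynomials\<close>

lemma qpoch_0 [simp]: "qpoch a q 0 = 1"
  by (simp add: qpoch_def)

lemma qpoch_Suc: "qpoch a q (Suc n) = qpoch a q n * (1 - a * q ^ n)"
  by (simp add: qpoch_def)

lemma qpoch_add: "qpoch a q (m + n) = qpoch a q m * qpoch (a * q ^ m) q n"
  by (induction n) (simp_all add: qpoch_Suc power_add mult_ac)

lemma cauchy_poly_0 [simp]: "cauchy_poly q 0 x y = 1"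
  by (simp add: cauchy_poly_def)

lemma cauchy_poly_Suc: "cauchy_poly q (Suc n) x y = cauchy_poly q n x y * (x - q ^ n * y)"
  by (simp add: cauchy_poly_def)

lemma cauchy_poly_0_right [simp]: "cauchy_poly q n x 0 = x ^ n"
  by (simp add: cauchy_poly_def)

lemma cauchy_poly_eq_qpoch: "x \<noteq> 0 \<Longrightarrow> cauchy_poly q n x y = x ^ n * qpoch (y / x) q n"
  by (induction n) (simp_all add: cauchy_poly_Suc qpoch_Suc field_simps)

lemma holomorphic_qpoch [holomorphic_intros]:
  "f holomorphic_on S \<Longrightarrow> (\<lambda>w. qpoch (f w) q n) holomorphic_on S"
  unfolding qpoch_def by (intro holomorphic_intros)

lemma holomorphic_cauchy_poly [holomorphic_intros]:
  "f holomorphic_on S \<Longrightarrow> g holomorphic_on S \<Longrightarrow>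
    (\<lambda>w. cauchy_poly q n (f w) (g w)) holomorphic_on S"
  unfolding cauchy_poly_def by (intro holomorphic_intros)

section \<open>Analytic preliminaries: series of functions, power series, dominant terms\<close>

text \<open>Weierstrass M-test: a majorant valid on all of \<open>S\<close> permits termwise
  differentiation.\<close>

lemma holomorphic_on_suminf:
  assumes "open S" and h: "summable h"
    and "\<And>n. f n holomorphic_on S"
    and le: "\<And>n x. x \<in> S \<Longrightarrow> norm (f n x) \<le> h n"
  shows "(\<lambda>x. \<Sum>n. f n x) holomorphic_on S"
proof -
  have hfd: "(f n has_field_derivative deriv (f n) x) (at x)" if "x \<in> S" for n x
    using assms that holomorphic_derivI by blast
  have "\<forall>\<^sub>F n in sequentially. \<forall>x\<in>S. norm (f n x) \<le> h n"
    using le by simp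
  from series_and_derivative_comparison[OF \<open>open S\<close> h hfd this]
  obtain g g' where g: "\<forall>x \<in> S. ((\<lambda>n. f n x) sums g x) \<and>
      ((\<lambda>n. deriv (f n) x) sums g' x) \<and> (g has_field_derivative g' x) (at x)" .
  then have "g holomorphic_on S"
    using \<open>open S\<close> holomorphic_on_open by blast
  then show ?thesis
    by (rule holomorphic_transform) (use g sums_unique in blast)
qed

text \<open>\<open>w\<close> lies on the boundary of the disc and is therefore a limit point of it.
  This supplies open sets for analytic continuation strictly inside a disc of convergence.\<close>

lemma open_Int_ball_norm_nonempty:
  fixes w :: complex
  assumes "open S" "w \<in> S" "w \<noteq> 0"
  shows "S \<inter> ball 0 (norm w) \<noteq> {}"
proof -
  have "w islimpt ball 0 (norm w)"
    using assms by (simp add: islimpt_ball)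
  then show ?thesis
    using assms by (auto simp: islimpt_def)
qed

text \<open>The difference of the two series represents 0, whereas the zeros of a nontrivial power
  series are isolated.\<close>

lemma powser_unique:
  fixes c d :: "nat \<Rightarrow> complex"
  assumes "0 < r"
    and "\<And>w. norm w < r \<Longrightarrow> summable (\<lambda>n. c n * w ^ n)"
    and "\<And>w. norm w < r \<Longrightarrow> (\<lambda>n. d n * w ^ n) sums (\<Sum>n. c n * w ^ n)"
  shows "c = d"
proof (rule ccontr)
  assume "c \<noteq> d"
  then obtain m where "c m \<noteq> d m" by auto
  then have m: "c m - d m \<noteq> 0" by simp
  have sums: "(\<lambda>n. (c n - d n) * w ^ n) sums 0" if "norm w < r" for w
    using sums_diff[OF summable_sums[OF assms(2)[OF that]] assms(3)[OF that]]
    by (simp add: algebra_simps)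
  \<comment> \<open>\<open>powser_0_nonzero\<close> asks for a nonzero coefficient of positive
    index; evaluation at 0 settles index 0.\<close>
  have "m \<noteq> 0"
    using sums[of 0] m \<open>0 < r\<close> by (auto intro!: Nat.gr0I)
  show False
  proof (rule powser_0_nonzero[of r 0 "\<lambda>n. c n - d n" "\<lambda>_. 0" m])
    fix s :: real
    assume "0 < s" "\<And>z::complex. z \<in> cball 0 s - {0} \<Longrightarrow> (0::complex) \<noteq> 0"
    from this(2)[of "of_real s"] this(1) show False by simp
  qed (use \<open>0 < r\<close> sums \<open>m \<noteq> 0\<close> m in auto)
qed

lemma sgn_factor_0 [simp]: "sgn_factor a b q 0 = 1"
  by (simp add: sgn_factor_def numeral_2_eq_2)

text \<open>Lets a generic point avoid the zeros of all Cauchy polynomials at once.\<close>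

lemma open_minus_countable_nonempty:
  fixes S :: "complex set"
  assumes "open S" "w \<in> S" "countable C"
  obtains z where "z \<in> S" "z \<notin> C"
proof -
  obtain e where "0 < e" "ball w e \<subseteq> S"
    using assms openE by blast
  then have "uncountable (S - C)"
    using uncountable_ball[of e w] \<open>countable C\<close> countable_subset uncountable_minus_countable
    by metis
  then have "S - C \<noteq> {}"
    by force
  then show ?thesis
    using that by blast
qed

text \<open>After division by \<open>y N ^ k\<close> every other summand tends to 0, so the norm of
  the quotient tends to \<open>norm (B N)\<close> and eventually exceeds half of it.\<close>

lemma sum_dominant_term:
  fixes y B :: "'a \<Rightarrow> complex"
  assumes "finite I" "N \<in> I" "B N \<noteq> 0" "y N \<noteq> 0"
    and less: "\<And>n. n \<in> I \<Longrightarrow> n \<noteq> N \<Longrightarrow> norm (y n) < norm (y N)"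
  shows "\<forall>\<^sub>F k in sequentially. norm (B N) / 2 * norm (y N) ^ k \<le> norm (\<Sum>n\<in>I. B n * y n ^ k)"
proof -
  have "(\<lambda>k. \<Sum>n\<in>I. B n * (y n / y N) ^ k) \<longlonglongrightarrow> (\<Sum>n\<in>I. if n = N then B N else 0)"
  proof (intro tendsto_sum)
    fix n assume "n \<in> I"
    show "(\<lambda>k. B n * (y n / y N) ^ k) \<longlonglongrightarrow> (if n = N then B N else 0)"
    proof (cases "n = N")
      case True
      then show ?thesis using assms by simp
    next
      case False
      then have "norm (y n / y N) < 1"
        using less[OF \<open>n \<in> I\<close>] assms by (simp add: norm_divide)
      then show ?thesis
        using False by (auto intro!: tendsto_mult_right_zero LIMSEQ_power_zero)
    qed
  qed
  then have "(\<lambda>k. norm (\<Sum>n\<in>I. B n * (y n / y N) ^ k)) \<longlonglongrightarrow> norm (B N)"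
    using assms by (auto intro: tendsto_norm)
  then have "\<forall>\<^sub>F k in sequentially. norm (B N) / 2 < norm (\<Sum>n\<in>I. B n * (y n / y N) ^ k)"
    using assms by (intro order_tendstoD(1)) auto
  then show ?thesis
  proof eventually_elim
    case (elim k)
    have "(\<Sum>n\<in>I. B n * (y n / y N) ^ k) * y N ^ k = (\<Sum>n\<in>I. B n * y n ^ k)"
      using assms by (simp add: sum_distrib_right power_divide)
    from this[symmetric]
    have "norm (\<Sum>n\<in>I. B n * y n ^ k) = norm (\<Sum>n\<in>I. B n * (y n / y N) ^ k) * norm (y N) ^ k"
      by (simp only: norm_mult norm_power)
    then show ?case
      using mult_right_mono[OF less_imp_le[OF elim], of "norm (y N) ^ k"] by simp
  qed
qed

text \<open>In the application \<open>y n\<close> is x t q^(1 - n). The recursion without division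
  keeps the exponent 1 - n out of the lemmas about the relation and covers \<open>y 0 = 0\<close> as
  well.\<close>

lemma geometric_sequence:
  fixes y :: "nat \<Rightarrow> 'a :: comm_monoid_mult"
  assumes y: "\<And>n. y (Suc n) * q = y n"
  shows "y (n + k) * q ^ k = y n"
proof (induction k)
  case (Suc k)
  have "y (n + Suc k) * q ^ Suc k = (y (Suc (n + k)) * q) * q ^ k"
    by (simp add: mult_ac)
  then show ?case
    using Suc y by simp
qed simp

section \<open>Infinite q-shifted factorials\<close>

context
  fixes q :: complex
  assumes q_less: "norm q < 1"
begin

lemma qpoch_inf_convergent: "convergent_prod (\<lambda>i. 1 - a * q ^ i)"
proof -
  have "summable (\<lambda>i. norm (1 - a * q ^ i - 1))"
    using q_less by (simp add: norm_mult norm_power summable_mult)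
  then show ?thesis
    using abs_convergent_prod_conv_summable abs_convergent_prod_imp_convergent_prod by blast
qed

lemma qpoch_tendsto: "(\<lambda>n. qpoch a q n) \<longlonglongrightarrow> qpoch_inf a q"
proof -
  have "(\<lambda>n. \<Prod>i\<le>n. 1 - a * q ^ i) \<longlonglongrightarrow> qpoch_inf a q"
    unfolding qpoch_inf_def by (rule convergent_prod_LIMSEQ[OF qpoch_inf_convergent])
  then have "(\<lambda>n. qpoch a q (Suc n)) \<longlonglongrightarrow> qpoch_inf a q"
    by (simp only: qpoch_def lessThan_Suc_atMost)
  then show ?thesis
    by (rule LIMSEQ_imp_Suc)
qed

text \<open>In a convergent infinite product only a vanishing factor can produce the value 0. Later
  claims about zeros of infinite products go back to this.\<close>

lemma qpoch_inf_eq_0_iff: "qpoch_inf a q = 0 \<longleftrightarrow> (\<exists>i. a * q ^ i = 1)"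
proof -
  have "(\<lambda>i. 1 - a * q ^ i) has_prod qpoch_inf a q"
    unfolding qpoch_inf_def using qpoch_inf_convergent by (rule convergent_prod_has_prod)
  from has_prod_eq_0_iff[OF this] show ?thesis
    by auto
qed

lemma qpoch_inf_nonzero: "norm a < 1 \<Longrightarrow> qpoch_inf a q \<noteq> 0"
  unfolding qpoch_inf_eq_0_iff
proof
  assume "norm a < 1" "\<exists>i. a * q ^ i = 1"
  then obtain i where i: "a * q ^ i = 1" by auto
  have "norm (a * q ^ i) \<le> norm a * 1"
    unfolding norm_mult norm_power using q_less by (intro mult_left_mono power_le_one) auto
  then show False
    using i \<open>norm a < 1\<close> by simp
qed

lemma qpoch_q_nonzero [simp]: "qpoch q q n \<noteq> 0"
proof -
  have "q * q ^ i \<noteq> 1" for i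
    using power_less_one_iff[of "norm q" "Suc i"] q_less
    by (metis norm_ge_zero norm_one norm_power power_Suc less_irrefl zero_less_Suc)
  then show ?thesis
    by (auto simp: qpoch_def)
qed

lemma qpoch_inf_split: "qpoch_inf a q = qpoch a q n * qpoch_inf (a * q ^ n) q"
proof (rule LIMSEQ_unique)
  show "(\<lambda>m. qpoch a q (m + n)) \<longlonglongrightarrow> qpoch_inf a q"
    using qpoch_tendsto by (rule LIMSEQ_ignore_initial_segment)
  show "(\<lambda>m. qpoch a q (m + n)) \<longlonglongrightarrow> qpoch a q n * qpoch_inf (a * q ^ n) q"
    unfolding add.commute[of _ n] qpoch_add by (intro tendsto_intros qpoch_tendsto)
qed

section \<open>Growth of Cauchy polynomials and convergence of series in them\<close>

text \<open>Each factor is at most \<open>\<rho> * exp (M / \<rho> * norm q ^ i)\<close>, and the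
  exponents are dominated by a convergent geometric series, so one constant serves all
  \<open>n\<close>, \<open>v\<close> and \<open>u\<close>.\<close>

lemma cauchy_poly_upper_bound:
  assumes "0 < \<rho>"
  obtains K where
    "\<And>n v u. norm v \<le> \<rho> \<Longrightarrow> norm u \<le> M \<Longrightarrow> norm (cauchy_poly q n v u) \<le> K * \<rho> ^ n"
proof
  fix n and v u :: complex
  assume v: "norm v \<le> \<rho>" and u: "norm u \<le> M"
  then have "0 \<le> M" using norm_ge_zero order_trans by blast
  have "norm (cauchy_poly q n v u) = (\<Prod>i<n. norm (v - q ^ i * u))"
    by (simp add: cauchy_poly_def prod_norm)
  also have "\<dots> \<le> (\<Prod>i<n. \<rho> * exp (M / \<rho> * norm q ^ i))"
  proof (intro prod_mono conjI norm_ge_zero)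
    fix i
    have "norm (v - q ^ i * u) \<le> norm v + norm (q ^ i * u)"
      by (rule norm_triangle_ineq4)
    also have "norm (q ^ i * u) \<le> norm q ^ i * M"
      using u by (simp add: norm_mult norm_power mult_left_mono)
    also have "norm v + norm q ^ i * M \<le> \<rho> * (1 + M / \<rho> * norm q ^ i)"
      using v assms by (simp add: field_simps)
    also have "\<dots> \<le> \<rho> * exp (M / \<rho> * norm q ^ i)"
      using assms by (intro mult_left_mono exp_ge_add_one_self) auto
    finally show "norm (v - q ^ i * u) \<le> \<rho> * exp (M / \<rho> * norm q ^ i)" by simp
  qed
  also have "\<dots> = \<rho> ^ n * exp (M / \<rho> * (\<Sum>i<n. norm q ^ i))"
    by (simp add: prod.distrib exp_sum sum_distrib_left)
  also have "\<dots> \<le> \<rho> ^ n * exp (M / \<rho> * (\<Sum>i. norm q ^ i))"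
    using q_less assms \<open>0 \<le> M\<close>
    by (intro mult_left_mono exp_mono sum_le_suminf) (auto simp: summable_geometric)
  finally show "norm (cauchy_poly q n v u) \<le> exp (M / \<rho> * (\<Sum>i. norm q ^ i)) * \<rho> ^ n"
    by (simp add: mult.commute)
qed

text \<open>P_n(v, u) is \<open>v ^ n\<close> times \<open>qpoch (u / v) q n\<close>; the latter is
  never 0 and has a nonzero limit, so its inverses are bounded.\<close>

lemma cauchy_poly_lower_bound:
  assumes "v \<noteq> 0" "\<And>i. v \<noteq> q ^ i * u"
  obtains K where "0 < K" "\<And>n. norm v ^ n \<le> K * norm (cauchy_poly q n v u)"
proof -
  have nz: "u / v * q ^ i \<noteq> 1" for i
  proof
    assume "u / v * q ^ i = 1"
    then have "v = q ^ i * u"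
      using assms(1) by (simp add: field_simps)
    then show False
      using assms(2) by blast
  qed
  have "qpoch_inf (u / v) q \<noteq> 0"
    unfolding qpoch_inf_eq_0_iff using nz by blast
  then have "(\<lambda>n. inverse (qpoch (u / v) q n)) \<longlonglongrightarrow> inverse (qpoch_inf (u / v) q)"
    by (intro tendsto_intros qpoch_tendsto)
  then have "Bseq (\<lambda>n. inverse (qpoch (u / v) q n))"
    using convergent_imp_Bseq convergent_def by blast
  then obtain K where K: "0 < K" "\<And>n. norm (inverse (qpoch (u / v) q n)) \<le> K"
    by (auto simp: Bseq_def)
  show ?thesis
  proof
    fix n
    have "qpoch (u / v) q n \<noteq> 0"
      using nz by (auto simp: qpoch_def)
    then have "0 < norm (qpoch (u / v) q n)" "1 / norm (qpoch (u / v) q n) \<le> K"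
      using K(2)[of n] by (simp_all add: norm_inverse inverse_eq_divide norm_divide)
    then have "1 \<le> K * norm (qpoch (u / v) q n)"
      by (simp add: pos_divide_le_eq)
    then have "norm v ^ n * 1 \<le> norm v ^ n * (K * norm (qpoch (u / v) q n))"
      by (intro mult_left_mono) auto
    then show "norm v ^ n \<le> K * norm (cauchy_poly q n v u)"
      by (simp add: cauchy_poly_eq_qpoch assms(1) norm_mult norm_power mult_ac)
  qed fact
qed

text \<open>Plays the role of Abel's lemma: convergence at one point off the zeros of all Cauchy
  polynomials controls the coefficients.\<close>

lemma summable_norm_power_of_cauchy:
  assumes "v \<noteq> 0" "\<And>i. v \<noteq> q ^ i * u"
    and "summable (\<lambda>n. norm (A n * cauchy_poly q n v u))"
  shows "summable (\<lambda>n. norm (A n) * norm v ^ n)"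
proof -
  obtain K where K: "0 < K" "\<And>n. norm v ^ n \<le> K * norm (cauchy_poly q n v u)"
    using cauchy_poly_lower_bound[OF assms(1,2)] by blast
  show ?thesis
  proof (rule summable_comparison_test')
    show "summable (\<lambda>n. K * norm (A n * cauchy_poly q n v u))"
      by (intro summable_mult assms)
    show "norm (norm (A n) * norm v ^ n) \<le> K * norm (A n * cauchy_poly q n v u)" for n
      using mult_left_mono[OF K(2)[of n], of "norm (A n)"]
      by (simp add: norm_mult mult_ac)
  qed
qed

text \<open>The upper bound gives a multiple of \<open>norm (A n) * \<rho> ^ n\<close> as majorant,
  for \<open>v\<close> in the disc and \<open>u\<close> in any bounded set. Hence the sum is
  holomorphic in \<open>v\<close> on the disc and entire in \<open>u\<close>.\<close>

lemma cauchy_series: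
  assumes \<rho>: "0 < \<rho>" and A: "summable (\<lambda>n. norm (A n) * \<rho> ^ n)"
  shows summable_cauchy_series:
      "norm v \<le> \<rho> \<Longrightarrow> summable (\<lambda>n. A n * cauchy_poly q n v u)"
    and holomorphic_cauchy_series_left:
      "(\<lambda>v. \<Sum>n. A n * cauchy_poly q n v u) holomorphic_on ball 0 \<rho>"
    and holomorphic_cauchy_series_right:
      "norm v \<le> \<rho> \<Longrightarrow> (\<lambda>u. \<Sum>n. A n * cauchy_poly q n v u) holomorphic_on ball 0 M"
proof -
  have bound: "\<exists>h. summable h \<and>
      (\<forall>n v u. norm v \<le> \<rho> \<longrightarrow> norm u \<le> M \<longrightarrow> norm (A n * cauchy_poly q n v u) \<le> h n)" for M
  proof -
    obtain K where K:
      "\<And>n v u. norm v \<le> \<rho> \<Longrightarrow> norm u \<le> M \<Longrightarrow> norm (cauchy_poly q n v u) \<le> K * \<rho> ^ n"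
      using cauchy_poly_upper_bound[OF \<rho>, of M] by blast
    show ?thesis
    proof (intro exI conjI allI impI)
      show "summable (\<lambda>n. K * (norm (A n) * \<rho> ^ n))"
        by (intro summable_mult A)
      fix n and v u :: complex assume "norm v \<le> \<rho>" "norm u \<le> M"
      then show "norm (A n * cauchy_poly q n v u) \<le> K * (norm (A n) * \<rho> ^ n)"
        using mult_left_mono[OF K, of v u "norm (A n)" n] by (simp add: norm_mult mult_ac)
    qed
  qed
  show "summable (\<lambda>n. A n * cauchy_poly q n v u)" if v: "norm v \<le> \<rho>"
  proof -
    obtain h where "summable h" "\<And>n. norm (A n * cauchy_poly q n v u) \<le> h n"
      using bound[of "norm u"] v order_refl by metis
    then show ?thesis
      by (rule summable_comparison_test')
  qed
  obtain h where h: "summable h" "\<And>n v. norm v \<le> \<rho> \<Longrightarrow> norm (A n * cauchy_poly q n v u) \<le> h n"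
    using bound[of "norm u"] order_refl by metis
  show "(\<lambda>v. \<Sum>n. A n * cauchy_poly q n v u) holomorphic_on ball 0 \<rho>"
    by (rule holomorphic_on_suminf[OF _ h(1)]) (auto intro!: holomorphic_intros h(2))
  obtain h where h: "summable h"
    "\<And>n v u. norm v \<le> \<rho> \<Longrightarrow> norm u \<le> M \<Longrightarrow> norm (A n * cauchy_poly q n v u) \<le> h n"
    using bound[of M] by metis
  show "(\<lambda>u. \<Sum>n. A n * cauchy_poly q n v u) holomorphic_on ball 0 M" if "norm v \<le> \<rho>"
    by (rule holomorphic_on_suminf[OF _ h(1)]) (auto intro!: holomorphic_intros h(2) that)
qed

section \<open>The q-binomial theorem\<close>

text \<open>As a function of w, the sum satisfies g(w) (1 - w v) = (1 - w u) g(w q); iteration from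
  \<open>y\<close> drives the argument to 0, where g is 1. The product form avoids dividing by
  \<open>qpoch_inf (y * v) q\<close>, which may vanish.\<close>

lemma q_binomial_theorem:
  assumes "summable (\<lambda>j. norm (y ^ j * cauchy_poly q j v u / qpoch q q j))"
  shows "(\<Sum>j. y ^ j * cauchy_poly q j v u / qpoch q q j) * qpoch_inf (y * v) q = qpoch_inf (y * u) q"
proof -
  define c where "c j = cauchy_poly q j v u / qpoch q q j" for j
  define g where "g w = (\<Sum>j. c j * w ^ j)" for w
  have sum_y: "summable (\<lambda>j. norm (c j * y ^ j))"
    using assms by (simp add: c_def mult.commute)
  have sum_le: "summable (\<lambda>j. c j * w ^ j)" if "norm w \<le> norm y" for w
  proof (rule summable_comparison_test'[OF sum_y])
    show "norm (c n * w ^ n) \<le> norm (c n * y ^ n)" for n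
      unfolding norm_mult norm_power using that by (intro mult_left_mono power_mono) auto
  qed
  have sum_q: "norm (y * q ^ n) \<le> norm y" for n
    unfolding norm_mult norm_power using q_less by (simp add: mult_left_le power_le_one)
  have rec: "c (Suc j) * (1 - q ^ Suc j) = c j * (v - q ^ j * u)" for j
  proof -
    have "qpoch q q (Suc j) \<noteq> 0" by simp
    then show ?thesis
      by (simp add: c_def cauchy_poly_Suc qpoch_Suc field_simps)
  qed
  have step: "g w * (1 - w * v) = (1 - w * u) * g (w * q)"
    if w: "norm w \<le> norm y" and wq: "norm (w * q) \<le> norm y" for w
  proof -
    \<comment> \<open>The constant term 1 is split off because it cancels in
      \<open>g w - g (w * q)\<close>; the remaining coefficients \<open>c (Suc j)\<close> are in the
      form that \<open>rec\<close> rewrites.\<close>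
    have tail: "(\<lambda>j. c (Suc j) * x ^ j * x) sums (g x - 1)" if "norm x \<le> norm y" for x
      using sums_mult2[OF summable_sums[OF powser_split_head(3)[OF sum_le[OF that]]], of x]
        powser_split_head(2)[OF sum_le[OF that]]
      by (simp add: g_def c_def)
    note 1 = tail[OF w] and 2 = tail[OF wq]
    have "(\<lambda>j. c (Suc j) * w ^ j * w - c (Suc j) * (w * q) ^ j * (w * q)) sums (g w - g (w * q))"
      using sums_diff[OF 1 2] by simp
    moreover have "c (Suc j) * w ^ j * w - c (Suc j) * (w * q) ^ j * (w * q) =
        w * v * (c j * w ^ j) - w * u * (c j * (w * q) ^ j)" for j
    proof -
      have "c (Suc j) * w ^ j * w - c (Suc j) * (w * q) ^ j * (w * q) =
          c (Suc j) * (1 - q ^ Suc j) * w ^ Suc j"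
        by (simp add: algebra_simps)
      then show ?thesis
        unfolding rec by (simp add: algebra_simps)
    qed
    ultimately have "(\<lambda>j. w * v * (c j * w ^ j) - w * u * (c j * (w * q) ^ j)) sums (g w - g (w * q))"
      by simp
    moreover have "(\<lambda>j. w * v * (c j * w ^ j) - w * u * (c j * (w * q) ^ j)) sums
        (w * v * g w - w * u * g (w * q))"
      unfolding g_def using sum_le[OF w] sum_le[OF wq]
      by (intro sums_diff sums_mult summable_sums)
    ultimately have "g w - g (w * q) = w * v * g w - w * u * g (w * q)"
      by (rule sums_unique2)
    then show ?thesis
      by (simp add: algebra_simps)
  qed
  have iter: "g y * qpoch (y * v) q n = qpoch (y * u) q n * g (y * q ^ n)" for n
  proof (induction n)
    case (Suc n)
    have "g y * qpoch (y * v) q (Suc n) = qpoch (y * u) q n * (g (y * q ^ n) * (1 - y * q ^ n * v))"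
      using Suc by (simp add: qpoch_Suc mult_ac)
    also have "\<dots> = qpoch (y * u) q n * ((1 - y * q ^ n * u) * g (y * q ^ n * q))"
      using step[OF sum_q[of n]] sum_q[of "Suc n"] by (simp add: mult_ac)
    finally show ?case
      by (simp add: qpoch_Suc mult_ac)
  qed simp
  have "(\<lambda>n. g (y * q ^ n)) \<longlonglongrightarrow> g 0"
  \<comment> \<open>Continuity of \<open>g\<close> at 0 comes from convergence at a point of larger
    modulus, which \<open>y\<close> is only if it is nonzero.\<close>
  proof (cases "y = 0")
    case False
    then have "isCont g 0"
      unfolding g_def using isCont_powser[OF sum_le[OF order_refl], of 0] by simp
    moreover have "(\<lambda>n. y * q ^ n) \<longlonglongrightarrow> 0"
      by (intro tendsto_mult_right_zero LIMSEQ_power_zero q_less)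
    ultimately show ?thesis
      by (rule isCont_tendsto_compose)
  qed simp
  then have "(\<lambda>n. g y * qpoch (y * v) q n) \<longlonglongrightarrow> qpoch_inf (y * u) q * g 0"
    unfolding iter by (rule tendsto_mult[OF qpoch_tendsto])
  then have "g y * qpoch_inf (y * v) q = qpoch_inf (y * u) q * g 0"
    by (rule LIMSEQ_unique[rotated]) (intro tendsto_mult tendsto_const qpoch_tendsto)
  also have "g 0 = c 0"
    unfolding g_def by (rule powser_zero)
  finally have "g y * qpoch_inf (y * v) q = qpoch_inf (y * u) q"
    by (simp add: c_def)
  then show ?thesis
    by (simp add: g_def c_def mult.commute)
qed

section \<open>Holomorphy of the infinite product\<close>

text \<open>Telescoping: consecutive partial products differ by
  \<open>- a * q ^ n * qpoch a q n\<close>, and \<open>qpoch a q n\<close> is P_n(1, a). The series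
  is one in Cauchy polynomials with \<open>a\<close> as second variable, hence entire in
  \<open>a\<close>.\<close>

lemma qpoch_inf_eq_series: "qpoch_inf a q = 1 - a * (\<Sum>n. q ^ n * cauchy_poly q n 1 a)"
proof -
  have qp: "cauchy_poly q n 1 a = qpoch a q n" for n
    by (simp add: cauchy_poly_eq_qpoch)
  have "(\<lambda>n. qpoch a q (Suc n) - qpoch a q n) sums (qpoch_inf a q - qpoch a q 0)"
    by (rule telescope_sums[OF qpoch_tendsto])
  then have "(\<lambda>n. (- a) * (q ^ n * cauchy_poly q n 1 a)) sums (qpoch_inf a q - 1)"
    by (simp add: qpoch_Suc qp algebra_simps)
  moreover have "summable (\<lambda>n. q ^ n * cauchy_poly q n 1 a)"
    using summable_cauchy_series[of 1 "\<lambda>n. q ^ n" 1 a] q_less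
    by (simp add: norm_power)
  then have "(\<lambda>n. (- a) * (q ^ n * cauchy_poly q n 1 a)) sums
      ((- a) * (\<Sum>n. q ^ n * cauchy_poly q n 1 a))"
    by (intro sums_mult summable_sums)
  ultimately have "qpoch_inf a q - 1 = (- a) * (\<Sum>n. q ^ n * cauchy_poly q n 1 a)"
    by (rule sums_unique2)
  then show ?thesis
    by (simp add: algebra_simps)
qed

lemma holomorphic_qpoch_inf [holomorphic_intros]:
  assumes "f holomorphic_on S"
  shows "(\<lambda>w. qpoch_inf (f w) q) holomorphic_on S"
proof -
  have "(\<lambda>a. \<Sum>n. q ^ n * cauchy_poly q n 1 a) holomorphic_on ball 0 M" for M
    using holomorphic_cauchy_series_right[of 1 "\<lambda>n. q ^ n" 1 M] q_less
    by (simp add: norm_power)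
  then have "(\<lambda>a. 1 - a * (\<Sum>n. q ^ n * cauchy_poly q n 1 a)) holomorphic_on ball 0 M" for M
    by (intro holomorphic_intros)
  then have hol: "(\<lambda>a. qpoch_inf a q) holomorphic_on ball 0 M" for M
    by (simp add: qpoch_inf_eq_series)
  have "(\<lambda>a. qpoch_inf a q) field_differentiable (at a)" for a
    using hol[of "norm a + 1"] by (auto intro: holomorphic_on_imp_differentiable_at)
  then have "(\<lambda>a. qpoch_inf a q) holomorphic_on f ` S"
    by (simp add: holomorphic_on_def field_differentiable_at_within)
  then show ?thesis
    using holomorphic_on_compose[OF assms] by (simp add: o_def)
qed

section \<open>The generating function of the polynomials \<open>Psi\<close>\<close>

text \<open>The prefactor of \<open>Psi\<close> cancels, \<open>qpoch q q m\<close> from the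
  q-binomial coefficient turns \<open>A m\<close> into the sum over \<open>I\<close>, and splitting
  \<open>y n ^ m\<close> as \<open>y n ^ k * y n ^ (m - k)\<close> leaves the coefficient of a
  Cauchy product.\<close>

lemma Psi_generating_term:
  assumes "q \<noteq> 0" and A: "A m * qpoch q q m = (\<Sum>n\<in>I. B n * y n ^ m)"
  shows "(-1) ^ m * q ^ (m choose 2) * A m * Psi a b q m u v z =
    (\<Sum>n\<in>I. B n * (\<Sum>k\<le>m. Phi_term a b q (y n * z) k *
      (y n ^ (m - k) * cauchy_poly q (m - k) v u / qpoch q q (m - k))))"
proof -
  have nz: "qpoch q q k \<noteq> 0" for k
    by (rule qpoch_q_nonzero)
  let ?w = "\<lambda>k. sgn_factor a b q k * W a b q k * cauchy_poly q (m - k) v u * z ^ k"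
  define S where "S = (\<Sum>k\<le>m. ?w k / (qpoch q q k * qpoch q q (m - k)))"
  have eq: "(\<Sum>k\<le>m. y n ^ m * (?w k / (qpoch q q k * qpoch q q (m - k)))) =
      (\<Sum>k\<le>m. Phi_term a b q (y n * z) k *
        (y n ^ (m - k) * cauchy_poly q (m - k) v u / qpoch q q (m - k)))" for n
  proof (rule sum.cong[OF refl])
    fix k assume "k \<in> {..m}"
    then have "y n ^ m = y n ^ k * y n ^ (m - k)"
      by (simp flip: power_add)
    then show "y n ^ m * (?w k / (qpoch q q k * qpoch q q (m - k))) = Phi_term a b q (y n * z) k *
      (y n ^ (m - k) * cauchy_poly q (m - k) v u / qpoch q q (m - k))"
      by (simp add: Phi_term_def power_mult_distrib)
  qed
  have "(-1) ^ m * q ^ (m choose 2) * A m * Psi a b q m u v z =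
      ((-1) ^ m * (-1) ^ m) * (q ^ (m choose 2) * q powi (- int (m choose 2))) * A m *
        (\<Sum>k\<le>m. qbinom q m k * ?w k)"
    by (simp add: Psi_def mult_ac)
  also have "\<dots> = A m * (\<Sum>k\<le>m. qbinom q m k * ?w k)"
    using \<open>q \<noteq> 0\<close> by (simp add: power_int_minus flip: power_mult_distrib)
  also have "(\<Sum>k\<le>m. qbinom q m k * ?w k) = qpoch q q m * S"
    by (simp add: S_def sum_distrib_left qbinom_def mult_ac)
  also have "A m * (qpoch q q m * S) = (\<Sum>n\<in>I. B n * y n ^ m) * S"
    by (simp add: A mult.assoc[symmetric])
  also have "\<dots> = (\<Sum>n\<in>I. B n * (y n ^ m * S))"
    by (simp add: sum_distrib_right mult.assoc)
  also have "\<dots> = (\<Sum>n\<in>I. B n * (\<Sum>k\<le>m. y n ^ m * (?w k / (qpoch q q k * qpoch q q (m - k)))))"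
    by (simp add: S_def sum_distrib_left)
  also have "\<dots> = (\<Sum>n\<in>I. B n * (\<Sum>k\<le>m. Phi_term a b q (y n * z) k *
      (y n ^ (m - k) * cauchy_poly q (m - k) v u / qpoch q q (m - k))))"
    by (simp only: eq)
  finally show ?thesis .
qed

text \<open>For each \<open>n\<close> this is a Cauchy product of two absolutely convergent series:
  one sums to \<open>Phi\<close>, the other is evaluated by the q-binomial theorem. Since
  \<open>I\<close> is finite, the results may be added up.\<close>

lemma Psi_generating_function:
  assumes "q \<noteq> 0" "finite I"
    and A: "\<And>k. A k * qpoch q q k = (\<Sum>n\<in>I. B n * y n ^ k)"
    and conv: "\<And>n. n \<in> I \<Longrightarrow> summable (\<lambda>j. norm (y n ^ j * cauchy_poly q j v u / qpoch q q j))"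
    and phi: "\<And>n. n \<in> I \<Longrightarrow> summable (\<lambda>k. norm (Phi_term a b q (y n * z) k))"
    and nz: "\<And>n. n \<in> I \<Longrightarrow> qpoch_inf (y n * v) q \<noteq> 0"
  shows "(\<lambda>n. (-1) ^ n * q ^ (n choose 2) * A n * Psi a b q n u v z) sums
    (\<Sum>n\<in>I. B n * (qpoch_inf (y n * u) q / qpoch_inf (y n * v) q) * Phi a b q (y n * z))"
proof -
  have "(\<lambda>m. \<Sum>k\<le>m. Phi_term a b q (y n * z) k *
      (y n ^ (m - k) * cauchy_poly q (m - k) v u / qpoch q q (m - k))) sums
      (Phi a b q (y n * z) * (qpoch_inf (y n * u) q / qpoch_inf (y n * v) q))" if "n \<in> I" for n
  proof -
    have "qpoch_inf (y n * u) q / qpoch_inf (y n * v) q =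
        (\<Sum>j. y n ^ j * cauchy_poly q j v u / qpoch q q j)"
      using q_binomial_theorem[OF conv[OF that]] nz[OF that] by (simp add: field_simps)
    then show ?thesis
      unfolding Phi_def using Cauchy_product_sums[OF phi[OF that] conv[OF that]] by simp
  qed
  then have "(\<lambda>m. \<Sum>n\<in>I. B n * (\<Sum>k\<le>m. Phi_term a b q (y n * z) k *
      (y n ^ (m - k) * cauchy_poly q (m - k) v u / qpoch q q (m - k)))) sums
      (\<Sum>n\<in>I. B n * (Phi a b q (y n * z) * (qpoch_inf (y n * u) q / qpoch_inf (y n * v) q)))"
    by (intro sums_sum sums_mult)
  then show ?thesis
    unfolding Psi_generating_term[where A = A and I = I and B = B and y = y, OF \<open>q \<noteq> 0\<close> A] by (simp add: mult_ac)
qed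

section \<open>Finite relations: convergence and coefficients\<close>

text \<open>The dominant term bounds \<open>norm (y n) ^ k\<close> by a multiple of
  \<open>norm (A k * qpoch q q k)\<close> for large \<open>k\<close>. In the application
  \<open>c k\<close> is P_k(v, u).\<close>

lemma summable_dominant:
  assumes "finite I" "N \<in> I" "B N \<noteq> 0" "y N \<noteq> 0"
    and less: "\<And>n. n \<in> I \<Longrightarrow> n \<noteq> N \<Longrightarrow> norm (y n) < norm (y N)"
    and A: "\<And>k. A k * qpoch q q k = (\<Sum>n\<in>I. B n * y n ^ k)"
    and summ: "summable (\<lambda>k. norm (A k * c k))"
    and "n \<in> I"
  shows "summable (\<lambda>k. norm (y n ^ k * c k / qpoch q q k))"
proof (rule summable_comparison_test_ev)
  show "summable (\<lambda>k. 2 / norm (B N) * norm (A k * c k))"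
    by (intro summable_mult summ)
  have le: "norm (y n) \<le> norm (y N)"
    using less[OF \<open>n \<in> I\<close>] by (cases "n = N") auto
  show "\<forall>\<^sub>F k in sequentially. norm (norm (y n ^ k * c k / qpoch q q k)) \<le> 2 / norm (B N) * norm (A k * c k)"
  proof (rule eventually_mono[OF sum_dominant_term[of I N B y, OF assms(1-5)]])
    fix k
    assume elim: "norm (B N) / 2 * norm (y N) ^ k \<le> norm (\<Sum>n\<in>I. B n * y n ^ k)"
    have pos: "0 < norm (qpoch q q k)" "0 < norm (B N)"
      using qpoch_q_nonzero \<open>B N \<noteq> 0\<close> by auto
    have "norm (y n) ^ k \<le> norm (y N) ^ k"
      using le by (intro power_mono) auto
    also have "\<dots> \<le> 2 / norm (B N) * (norm (A k) * norm (qpoch q q k))"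
      using elim pos by (simp add: A[symmetric] norm_mult field_simps)
    finally have "norm (y n) ^ k * (norm (c k) / norm (qpoch q q k)) \<le>
        2 / norm (B N) * (norm (A k) * norm (qpoch q q k)) * (norm (c k) / norm (qpoch q q k))"
      by (intro mult_right_mono) auto
    also have "\<dots> = 2 / norm (B N) * norm (A k * c k)"
      using pos by (simp add: norm_mult)
    finally show "norm (norm (y n ^ k * c k / qpoch q q k)) \<le> 2 / norm (B N) * norm (A k * c k)"
      by (simp add: norm_mult norm_divide norm_power)
  qed
qed

text \<open>\<open>V\<close> may stay away from 0, so coefficients cannot be compared at once. Each
  \<open>y n\<close> is \<open>Y\<close> times a power of q, hence
  \<open>qpoch_inf (Y * v) q\<close> clears every denominator; the cleared identity extends to the
  disc, and near 0 one divides back and expands by Euler's formula.\<close>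

lemma coefficients_of_finite_relation:
  fixes A :: "nat \<Rightarrow> complex" and B y :: "'a \<Rightarrow> complex"
  assumes "finite I" and y: "\<And>n. n \<in> I \<Longrightarrow> y n = Y * q ^ e n"
    and V: "open V" "V \<noteq> {}" "V \<subseteq> ball 0 \<rho>"
    and \<rho>: "0 < \<rho>" and A: "summable (\<lambda>n. norm (A n) * \<rho> ^ n)"
    and nz: "\<And>v n. v \<in> V \<Longrightarrow> n \<in> I \<Longrightarrow> qpoch_inf (y n * v) q \<noteq> 0"
    and rel: "\<And>v. v \<in> V \<Longrightarrow> (\<Sum>n. A n * v ^ n) = (\<Sum>n\<in>I. B n / qpoch_inf (y n * v) q)"
  shows "A k * qpoch q q k = (\<Sum>n\<in>I. B n * y n ^ k)"
proof -
  have split: "qpoch_inf (Y * v) q = qpoch (Y * v) q (e n) * qpoch_inf (y n * v) q" if "n \<in> I" for n v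
    using qpoch_inf_split[of "Y * v" "e n"] y[OF that] by (simp add: mult_ac)
  have summ: "summable (\<lambda>n. A n * v ^ n)" if "norm v \<le> \<rho>" for v
    using summable_cauchy_series[OF \<rho> A that, of 0] by simp
  have cleared: "(\<Sum>n. A n * v ^ n) * qpoch_inf (Y * v) q = (\<Sum>n\<in>I. B n * qpoch (Y * v) q (e n))"
    if "v \<in> ball 0 \<rho>" for v
  proof (rule analytic_continuation_open[OF V(1) open_ball V(2) connected_ball V(3) _ _ _ that])
    show "(\<lambda>v. (\<Sum>n. A n * v ^ n) * qpoch_inf (Y * v) q) holomorphic_on ball 0 \<rho>"
      using holomorphic_cauchy_series_left[OF \<rho> A, of 0]
      by (intro holomorphic_intros holomorphic_qpoch_inf) auto
    show "(\<lambda>v. \<Sum>n\<in>I. B n * qpoch (Y * v) q (e n)) holomorphic_on ball 0 \<rho>"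
      by (intro holomorphic_intros)
    show "(\<Sum>n. A n * v ^ n) * qpoch_inf (Y * v) q = (\<Sum>n\<in>I. B n * qpoch (Y * v) q (e n))"
      if "v \<in> V" for v
      unfolding rel[OF that] sum_distrib_right
      by (rule sum.cong[OF refl]) (use nz[OF that] split in auto)
  qed
  \<comment> \<open>The second bound forces \<open>norm (Y * v) < 1\<close>; the added 1 covers
    \<open>Y = 0\<close>.\<close>
  define r where "r = min \<rho> (1 / (norm Y + 1))"
  have "0 < norm Y + 1"
    using norm_ge_zero[of Y] by linarith
  then have "0 < r"
    using \<rho> by (simp add: r_def)
  have Yv: "norm (Y * v) < 1" if "norm v < r" for v
  proof -
    have "norm v * (norm Y + 1) < 1"
      using that \<open>0 < norm Y + 1\<close> by (simp add: r_def pos_less_divide_eq)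
    moreover have "norm Y * norm v \<le> norm v * (norm Y + 1)"
      by (simp add: algebra_simps)
    ultimately show ?thesis
      by (simp add: norm_mult)
  qed
  \<comment> \<open>Euler's expansion is the q-binomial theorem for the polynomials P_k(1, 0) =
    1.\<close>
  have euler: "(\<lambda>k. y n ^ k / qpoch q q k * v ^ k) sums (1 / qpoch_inf (y n * v) q)"
    if "norm v < r" "n \<in> I" for v n
  proof -
    let ?w = "y n * v"
    have "norm ?w \<le> norm (Y * v) * 1"
      unfolding y[OF \<open>n \<in> I\<close>] norm_mult norm_power using q_less
      by (simp add: mult_right_mono mult_left_le power_le_one)
    then have w: "norm ?w < 1"
      using Yv[OF that(1)] by simp
    \<comment> \<open>\<open>qpoch q q k\<close> is P_k(1, q), so the lower bound for Cauchy
      polynomials provides \<open>L\<close>.\<close>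
    obtain L where L: "\<And>k. 1 \<le> L * norm (qpoch q q k)"
    proof -
      have "(1::complex) \<noteq> q ^ i * q" for i
        using qpoch_q_nonzero[of "Suc i"] by (auto simp: qpoch_Suc mult.commute)
      then show ?thesis
        using cauchy_poly_lower_bound[of 1 q] that
        by (metis cauchy_poly_eq_qpoch div_by_1 mult_1 norm_one power_one zero_neq_one)
    qed
    have abs: "summable (\<lambda>k. norm (?w ^ k * cauchy_poly q k 1 0 / qpoch q q k))"
    proof (rule summable_comparison_test')
      show "summable (\<lambda>k. L * norm ?w ^ k)"
        using w by (intro summable_mult summable_geometric) simp
      show "norm (norm (?w ^ k * cauchy_poly q k 1 0 / qpoch q q k)) \<le> L * norm ?w ^ k" for k
      proof -
        have "0 < norm (qpoch q q k)"
          using qpoch_q_nonzero by simp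
        then have "1 / norm (qpoch q q k) \<le> L"
          using L[of k] by (simp add: pos_divide_le_eq)
        then have "norm ?w ^ k * (1 / norm (qpoch q q k)) \<le> norm ?w ^ k * L"
          by (intro mult_left_mono) auto
        then show ?thesis
          by (simp add: norm_divide norm_power mult.commute)
      qed
    qed
    have "(\<Sum>k. ?w ^ k * cauchy_poly q k 1 0 / qpoch q q k) * qpoch_inf ?w q = 1"
      using q_binomial_theorem[OF abs] by (simp add: qpoch_inf_def)
    then have "(\<Sum>k. ?w ^ k * cauchy_poly q k 1 0 / qpoch q q k) = 1 / qpoch_inf ?w q"
      using qpoch_inf_nonzero[OF w] by (simp add: field_simps)
    then show ?thesis
      using summable_sums[OF summable_norm_cancel[OF abs]] by (simp add: power_mult_distrib)
  qed
  have "A = (\<lambda>k. (\<Sum>n\<in>I. B n * y n ^ k) / qpoch q q k)"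
  proof (rule powser_unique[OF \<open>0 < r\<close>])
    fix v :: complex
    assume v: "norm v < r"
    then have v\<rho>: "norm v < \<rho>"
      by (simp add: r_def)
    then show "summable (\<lambda>n. A n * v ^ n)"
      using summ by simp
    have "(\<lambda>k. \<Sum>n\<in>I. B n * (y n ^ k / qpoch q q k * v ^ k)) sums
        (\<Sum>n\<in>I. B n * (1 / qpoch_inf (y n * v) q))"
      using euler[OF v] by (intro sums_sum sums_mult)
    also have "(\<lambda>k. \<Sum>n\<in>I. B n * (y n ^ k / qpoch q q k * v ^ k)) =
        (\<lambda>k. (\<Sum>n\<in>I. B n * y n ^ k) / qpoch q q k * v ^ k)"
      by (simp add: sum_distrib_right sum_divide_distrib mult.assoc)
    also have "(\<Sum>n\<in>I. B n * (1 / qpoch_inf (y n * v) q)) = (\<Sum>n. A n * v ^ n)"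
    proof -
      have nzY: "qpoch_inf (Y * v) q \<noteq> 0"
        using qpoch_inf_nonzero[OF Yv[OF v]] .
      have "(\<Sum>n\<in>I. B n * (1 / qpoch_inf (y n * v) q)) * qpoch_inf (Y * v) q =
          (\<Sum>n\<in>I. B n * qpoch (Y * v) q (e n))"
        unfolding sum_distrib_right
        by (rule sum.cong[OF refl]) (use split nzY in auto)
      also have "\<dots> = (\<Sum>n. A n * v ^ n) * qpoch_inf (Y * v) q"
        using cleared v\<rho> by simp
      finally show ?thesis
        using nzY by simp
    qed
    finally show "(\<lambda>k. (\<Sum>n\<in>I. B n * y n ^ k) / qpoch q q k * v ^ k) sums (\<Sum>n. A n * v ^ n)" .
  qed
  then have "A k = (\<Sum>n\<in>I. B n * y n ^ k) / qpoch q q k"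
    by (rule fun_cong)
  then show ?thesis
    using qpoch_q_nonzero by simp
qed

section \<open>Rigidity of the relation on an open set\<close>

text \<open>
  Up to factors not involving \<open>n\<close> and \<open>u\<close> together, the numerators of the right-hand series of the
  relation are again Cauchy polynomials, so both series obey the same convergence theory.
\<close>

lemma qpoch_inf_reverse:
  assumes y: "\<And>n. y (Suc n) * q = y n" and "y 0 \<noteq> 0"
  shows "qpoch_inf (y n * u) q =
    (\<Prod>i<n. - y (Suc i)) * cauchy_poly q n u (q / y 0) * qpoch_inf (y 0 * u) q"
proof (induction n)
  case (Suc n)
  have "y (Suc n) * q ^ Suc n = y 0"
    using geometric_sequence[of y q 0 "Suc n", OF y] by simp
  then have "y (Suc n) * (q ^ n * (q / y 0)) = 1"
    using \<open>y 0 \<noteq> 0\<close> by (simp add: mult_ac)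
  then have "1 - y (Suc n) * u = - y (Suc n) * (u - q ^ n * (q / y 0))"
    by (simp add: algebra_simps)
  moreover have shift: "y (Suc n) * u * q ^ 1 = y n * u"
    unfolding y[of n, symmetric] by (simp add: mult_ac)
  have "qpoch_inf (y (Suc n) * u) q = (1 - y (Suc n) * u) * qpoch_inf (y n * u) q"
    using qpoch_inf_split[of "y (Suc n) * u" 1] unfolding shift
    by (simp add: qpoch_Suc)
  ultimately show ?case
    using Suc by (simp add: cauchy_poly_Suc mult_ac)
qed simp

text \<open>For fixed \<open>v\<close> in \<open>V\<close> both sides are holomorphic in
  \<open>u\<close> on one disc about 0 and agree on an open part of it. The radii are
  \<open>norm u0\<close> and \<open>norm v1\<close> for a generic point \<open>(u0, v1)\<close> of
  \<open>D\<close>.\<close>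

lemma extend_relation:
  assumes "q \<noteq> 0" and y: "\<And>n. y (Suc n) * q = (y n :: complex)"
    and D: "open D" "D \<noteq> {}"
    and nz: "\<And>u v n. (u, v) \<in> D \<Longrightarrow> B n \<noteq> 0 \<Longrightarrow> qpoch_inf (y n * v) q \<noteq> 0"
    and summA: "\<And>u v. (u, v) \<in> D \<Longrightarrow> summable (\<lambda>n. norm (A n * cauchy_poly q n v u))"
    and summB: "\<And>u v. (u, v) \<in> D \<Longrightarrow>
      summable (\<lambda>n. norm (B n * (qpoch_inf (y n * u) q / qpoch_inf (y n * v) q)))"
    and rel: "\<And>u v. (u, v) \<in> D \<Longrightarrow> (\<Sum>n. A n * cauchy_poly q n v u) =
      (\<Sum>n. B n * (qpoch_inf (y n * u) q / qpoch_inf (y n * v) q))"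
  obtains V r \<rho> where "open V" "V \<noteq> {}" "V \<subseteq> ball 0 \<rho>" "0 < r" "0 < \<rho>"
    "summable (\<lambda>n. norm (A n) * \<rho> ^ n)"
    "\<And>v n. v \<in> V \<Longrightarrow> B n \<noteq> 0 \<Longrightarrow> qpoch_inf (y n * v) q \<noteq> 0"
    "\<And>u v. v \<in> V \<Longrightarrow> norm u < r \<Longrightarrow> (\<Sum>n. A n * cauchy_poly q n v u) =
      (\<Sum>n. B n * (qpoch_inf (y n * u) q / qpoch_inf (y n * v) q))"
proof -
  obtain us vs where "(us, vs) \<in> D"
    using D by auto
  then obtain U V0 where U: "open U" "us \<in> U" and V0: "open V0" "vs \<in> V0" and UV: "U \<times> V0 \<subseteq> D"
    using open_prod_elim[OF D(1)] by (metis mem_Sigma_iff)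
  \<comment> \<open>Off countably many values no Cauchy polynomial vanishes, so convergence at \<open>(u0, v1)\<close>
    bounds the coefficients of both series.\<close>
  have "countable (insert 0 (range (\<lambda>j. q ^ j * (q / y 0)) \<union> range (\<lambda>j. 1 / (y 0 * q ^ j))))"
    by (intro countable_insert countable_Un) auto
  from open_minus_countable_nonempty[OF U this] obtain u0 where u0: "u0 \<in> U"
    "u0 \<notin> insert 0 (range (\<lambda>j. q ^ j * (q / y 0)) \<union> range (\<lambda>j. 1 / (y 0 * q ^ j)))" .
  have "countable (insert 0 (range (\<lambda>i. q ^ i * u0)))"
    by (intro countable_insert) auto
  from open_minus_countable_nonempty[OF V0 this] obtain v1 where v1: "v1 \<in> V0"
    "v1 \<notin> insert 0 (range (\<lambda>i. q ^ i * u0))" .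
  define V where "V = V0 \<inter> ball 0 (norm v1)"
  have "V0 \<inter> ball 0 (norm v1) \<noteq> {}" "U \<inter> ball 0 (norm u0) \<noteq> {}"
    using open_Int_ball_norm_nonempty U V0 u0 v1 by auto
  have \<rho>: "0 < norm v1" and r: "0 < norm u0"
    using v1 u0 by auto
  have "(u0, v1) \<in> D"
    using u0 v1 UV by auto
  then have sA: "summable (\<lambda>n. norm (A n) * norm v1 ^ n)"
    using v1 by (intro summable_norm_power_of_cauchy[OF _ _ summA]) auto
  \<comment> \<open>Reversal turns the right-hand side into a series of Cauchy polynomials with
    \<open>u\<close> as first variable and \<open>q / y 0\<close> as second, so convergence at
    \<open>u0\<close> gives holomorphy on the whole disc of radius \<open>norm u0\<close>.\<close>
  have holE: "(\<lambda>u. \<Sum>n. B n * (qpoch_inf (y n * u) q / qpoch_inf (y n * v) q)) holomorphic_on ball 0 (norm u0)"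
    if "v \<in> V" for v
  proof (cases "y 0 = 0")
    case True
    have "y n = 0" for n
      using geometric_sequence[of y q 0 n, OF y] True \<open>q \<noteq> 0\<close> by simp
    then show ?thesis by simp
  next
    case False
    define c where "c = q / y 0"
    define B' where "B' n = B n * (\<Prod>i<n. - y (Suc i)) / qpoch_inf (y n * v) q" for n
    have eq: "B n * (qpoch_inf (y n * u) q / qpoch_inf (y n * v) q) =
        qpoch_inf (y 0 * u) q * (B' n * cauchy_poly q n u c)" for n u
      unfolding qpoch_inf_reverse[OF y False, of n u] by (simp add: B'_def c_def)
    have "(u0, v) \<in> D"
      using u0 that UV by (auto simp: V_def)
    from summB[OF this] have "summable (\<lambda>n. norm (qpoch_inf (y 0 * u0) q) * norm (B' n * cauchy_poly q n u0 c))"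
      by (simp only: eq norm_mult)
    \<comment> \<open>The values \<open>1 / (y 0 * q ^ j)\<close> were excluded for
      \<open>u0\<close> so that this factor can be cancelled; the values
      \<open>q ^ j * (q / y 0)\<close> were excluded to keep every P_n(u0, c) nonzero.\<close>
    moreover have "qpoch_inf (y 0 * u0) q \<noteq> 0"
      unfolding qpoch_inf_eq_0_iff
    proof
      assume "\<exists>i. y 0 * u0 * q ^ i = 1"
      then obtain i where i: "y 0 * u0 * q ^ i = 1" ..
      then have "u0 = 1 / (y 0 * q ^ i)"
        using False \<open>q \<noteq> 0\<close> by (simp add: field_simps)
      then show False
        using u0 by blast
    qed
    ultimately have "summable (\<lambda>n. norm (B' n * cauchy_poly q n u0 c))"
      using summable_mult_D by fastforce
    then have sB: "summable (\<lambda>n. norm (B' n) * norm u0 ^ n)"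
      using u0 by (intro summable_norm_power_of_cauchy) (auto simp: c_def)
    have "(\<lambda>u. qpoch_inf (y 0 * u) q * (\<Sum>n. B' n * cauchy_poly q n u c)) holomorphic_on ball 0 (norm u0)"
      by (intro holomorphic_intros holomorphic_qpoch_inf
          holomorphic_cauchy_series_left[OF r sB])
    then show ?thesis
    proof (rule holomorphic_transform)
      fix u :: complex assume "u \<in> ball 0 (norm u0)"
      then have "summable (\<lambda>n. B' n * cauchy_poly q n u c)"
        by (intro summable_cauchy_series[OF r sB]) auto
      then show "qpoch_inf (y 0 * u) q * (\<Sum>n. B' n * cauchy_poly q n u c) =
          (\<Sum>n. B n * (qpoch_inf (y n * u) q / qpoch_inf (y n * v) q))"
        unfolding eq by (rule suminf_mult[symmetric])
    qed
  qed
  show thesis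
  proof (rule that[of V "norm v1" "norm u0"])
    fix u v :: complex assume v: "v \<in> V" and u: "norm u < norm u0"
    show "(\<Sum>n. A n * cauchy_poly q n v u) =
      (\<Sum>n. B n * (qpoch_inf (y n * u) q / qpoch_inf (y n * v) q))"
    proof (rule analytic_continuation_open[where s = "U \<inter> ball 0 (norm u0)" and s' = "ball 0 (norm u0)"
          and f = "\<lambda>u. \<Sum>n. A n * cauchy_poly q n v u"
          and g = "\<lambda>u. \<Sum>n. B n * (qpoch_inf (y n * u) q / qpoch_inf (y n * v) q)",
          OF _ open_ball _ connected_ball Int_lower2])
      show "open (U \<inter> ball 0 (norm u0))" "U \<inter> ball 0 (norm u0) \<noteq> {}" "u \<in> ball 0 (norm u0)"
        using U u \<open>U \<inter> ball 0 (norm u0) \<noteq> {}\<close> by auto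
      show "(\<lambda>u. \<Sum>n. A n * cauchy_poly q n v u) holomorphic_on ball 0 (norm u0)"
        using v by (intro holomorphic_cauchy_series_right[OF \<rho> sA]) (auto simp: V_def)
      show "(\<lambda>u. \<Sum>n. B n * (qpoch_inf (y n * u) q / qpoch_inf (y n * v) q)) holomorphic_on ball 0 (norm u0)"
        using holE v .
      show "(\<Sum>n. A n * cauchy_poly q n v u) =
        (\<Sum>n. B n * (qpoch_inf (y n * u) q / qpoch_inf (y n * v) q))" if "u \<in> U \<inter> ball 0 (norm u0)" for u
        using that v UV by (intro rel) (auto simp: V_def)
    qed
  next
    show "qpoch_inf (y n * v) q \<noteq> 0" if "v \<in> V" "B n \<noteq> 0" for v n
      using that UV U nz[of us v n] by (auto simp: V_def)
  qed (use \<open>V0 \<inter> ball 0 (norm v1) \<noteq> {}\<close> V0 \<rho> r sA in \<open>auto simp: V_def\<close>)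
qed

text \<open>\<open>qpoch_inf (y m * v) q\<close> contains every denominator with
  \<open>n \<le> m\<close> and leaves the factor \<open>qpoch (y m * v) q (m - n)\<close>. At
  \<open>v = 1 / y m\<close> this is \<open>qpoch 1 q (m - n)\<close>, which isolates
  \<open>n = m\<close>.\<close>

lemma relation_coefficient_eq_0:
  assumes "q \<noteq> 0" and y: "\<And>n. y (Suc n) * q = (y n :: complex)" and "y 0 \<noteq> 0"
    and V: "open V" "V \<noteq> {}" "V \<subseteq> ball 0 \<rho>"
    and \<rho>: "0 < \<rho>" and A: "summable (\<lambda>n. norm (A n) * \<rho> ^ n)"
    and nz: "\<And>v n. v \<in> V \<Longrightarrow> B n \<noteq> 0 \<Longrightarrow> qpoch_inf (y n * v) q \<noteq> 0"
    and rel: "\<And>v. v \<in> V \<Longrightarrow> (\<Sum>n. A n * cauchy_poly q n v (1 / y (Suc m))) =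
      (\<Sum>n. B n * (qpoch_inf (y n * (1 / y (Suc m))) q / qpoch_inf (y n * v) q))"
    and m: "norm (1 / y m) < \<rho>"
  shows "B m = 0"
proof -
  define u where "u = 1 / y (Suc m)"
  have geo: "y (n + k) * q ^ k = y n" for n k
    using geometric_sequence[of y q, OF y] .
  have y_nz: "y n \<noteq> 0" for n
    using geo[of 0 n] \<open>y 0 \<noteq> 0\<close> by auto
  \<comment> \<open>Here \<open>y n * u\<close> is q to the power -(n - m - 1), so the factor of
    index \<open>n - Suc m\<close> is 0 and the right-hand series becomes a finite sum.\<close>
  have vanish: "qpoch_inf (y n * u) q = 0" if "m < n" for n
  proof -
    have "y n * u * q ^ (n - Suc m) = 1"
      using geo[of "Suc m" "n - Suc m"] that y_nz[of "Suc m"] by (simp add: u_def field_simps)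
    then show ?thesis
      unfolding qpoch_inf_eq_0_iff by blast
  qed
  let ?g = "\<lambda>v. \<Sum>n\<le>m. B n * qpoch_inf (y n * u) q * qpoch (y m * v) q (m - n)"
  have "(\<Sum>n. A n * cauchy_poly q n v u) * qpoch_inf (y m * v) q = ?g v" if "v \<in> ball 0 \<rho>" for v
  proof (rule analytic_continuation_open[OF V(1) open_ball V(2) connected_ball V(3) _ _ _ that])
    show "(\<lambda>v. (\<Sum>n. A n * cauchy_poly q n v u) * qpoch_inf (y m * v) q) holomorphic_on ball 0 \<rho>"
      by (intro holomorphic_intros holomorphic_qpoch_inf
          holomorphic_cauchy_series_left[OF \<rho> A])
    show "?g holomorphic_on ball 0 \<rho>"
      by (intro holomorphic_intros)
    show "(\<Sum>n. A n * cauchy_poly q n v u) * qpoch_inf (y m * v) q = ?g v" if "v \<in> V" for v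
    proof -
      have "(\<Sum>n. A n * cauchy_poly q n v u) =
          (\<Sum>n\<le>m. B n * (qpoch_inf (y n * u) q / qpoch_inf (y n * v) q))"
        unfolding u_def rel[OF that]
        by (rule suminf_finite) (use vanish in \<open>auto simp: u_def\<close>)
      moreover have "B n * (qpoch_inf (y n * u) q / qpoch_inf (y n * v) q) * qpoch_inf (y m * v) q =
          B n * qpoch_inf (y n * u) q * qpoch (y m * v) q (m - n)" if "n \<le> m" for n
      proof -
        have "qpoch_inf (y m * v) q = qpoch (y m * v) q (m - n) * qpoch_inf (y n * v) q"
          using qpoch_inf_split[of "y m * v" "m - n"] geo[of n "m - n"] that
          by (simp add: mult_ac)
        then show ?thesis
          using nz[OF \<open>v \<in> V\<close>, of n] by auto
      qed
      ultimately show ?thesis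
        by (simp add: sum_distrib_right)
    qed
  qed
  from this[of "1 / y m"] have "?g (1 / y m) = (\<Sum>n. A n * cauchy_poly q n (1 / y m) u) * qpoch_inf 1 q"
    using m y_nz[of m] by simp
  also have "qpoch_inf 1 q = 0"
    unfolding qpoch_inf_eq_0_iff by (auto intro: exI[of _ 0])
  also have "?g (1 / y m) = (\<Sum>n\<le>m. if n = m then B m * qpoch_inf (y m * u) q else 0)"
  proof (rule sum.cong[OF refl])
    fix n assume "n \<in> {..m}"
    have "qpoch 1 q (m - n) = 0" if "n \<noteq> m"
      using that \<open>n \<in> {..m}\<close> by (auto simp: qpoch_def intro!: bexI[of _ 0])
    then show "B n * qpoch_inf (y n * u) q * qpoch (y m * (1 / y m)) q (m - n) =
        (if n = m then B m * qpoch_inf (y m * u) q else 0)"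
      using y_nz[of m] by auto
  qed
  \<comment> \<open>The surviving numerator is therefore \<open>qpoch_inf q q\<close>, which is
    nonzero because \<open>norm q < 1\<close>.\<close>
  also have "y m * u = q"
    using y[of m] y_nz[of "Suc m"] by (simp add: u_def field_simps)
  finally show ?thesis
    using qpoch_inf_nonzero[OF q_less] by simp
qed

end

section \<open>Values at argument 0 and the transfer to \<open>Psi\<close>\<close>

lemma qpochs_0 [simp]: "qpochs cs q 0 = 1"
  by (induction cs) (simp_all add: qpochs_def)

lemma Phi_0 [simp]: "Phi a b q 0 = 1"
proof -
  have "Phi_term a b q 0 k = (if k = 0 then 1 else 0)" for k
    by (simp add: Phi_term_def W_def)
  then show ?thesis
    using sums_unique[OF sums_single[of 0 "\<lambda>_. 1 :: complex"]] by (simp add: Phi_def)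
qed

lemma summable_Phi_term_0: "summable (\<lambda>k. norm (Phi_term a b q 0 k))"
  by (rule summable_finite[of "{0}"]) (auto simp: Phi_term_def)

lemma qpoch_inf_0 [simp]: "qpoch_inf 0 q = 1"
  by (simp add: qpoch_inf_def)

text \<open>The relation at u = 0 on \<open>V\<close> determines the coefficients
  \<open>A k\<close>; the point \<open>(u, v)\<close> itself contributes convergence and
  nonvanishing denominators.\<close>

lemma Psi_transfer_finite:
  assumes q: "norm q < 1" "q \<noteq> 0" and y: "\<And>n. y (Suc n) * q = (y n :: complex)" and "y 0 \<noteq> 0"
    and fin: "finite {n. B n \<noteq> 0}"
    and V: "open V" "V \<noteq> {}" "V \<subseteq> ball 0 \<rho>"
    and \<rho>: "0 < \<rho>" and A: "summable (\<lambda>n. norm (A n) * \<rho> ^ n)"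
    and nzV: "\<And>v n. v \<in> V \<Longrightarrow> B n \<noteq> 0 \<Longrightarrow> qpoch_inf (y n * v) q \<noteq> 0"
    and rel: "\<And>v. v \<in> V \<Longrightarrow> (\<Sum>n. A n * v ^ n) = (\<Sum>n. B n / qpoch_inf (y n * v) q)"
    and summ: "summable (\<lambda>n. norm (A n * cauchy_poly q n v u))"
    and phi: "\<And>n. B n \<noteq> 0 \<Longrightarrow> summable (\<lambda>k. norm (Phi_term a b q (y n * z) k))"
    and nz: "\<And>n. B n \<noteq> 0 \<Longrightarrow> qpoch_inf (y n * v) q \<noteq> 0"
  shows "(\<lambda>n. (-1) ^ n * q ^ (n choose 2) * A n * Psi a b q n u v z) sums
    (\<Sum>n. B n * (qpoch_inf (y n * u) q / qpoch_inf (y n * v) q) * Phi a b q (y n * z))"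
proof -
  define I where "I = {n. B n \<noteq> 0}"
  \<comment> \<open>As \<open>norm (y n)\<close> grows with \<open>n\<close>, the largest index
    supplies both the common denominator and the dominant term. For empty \<open>I\<close> the value
    of \<open>Max\<close> is immaterial.\<close>
  define N where "N = Max I"
  have I: "finite I"
    using fin by (simp add: I_def)
  have geo: "y (n + k) * q ^ k = y n" for n k
    using geometric_sequence[of y q, OF y] .
  have le_N: "n \<le> N" if "n \<in> I" for n
    using I that by (simp add: N_def)
  have y_eq: "y n = y N * q ^ (N - n)" if "n \<in> I" for n
    using geo[of n "N - n"] le_N[OF that] by simp
  have y_nz: "y n \<noteq> 0" for n
    using geo[of 0 n] \<open>y 0 \<noteq> 0\<close> by auto
  have coeff: "A k * qpoch q q k = (\<Sum>n\<in>I. B n * y n ^ k)" for k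
  proof (rule coefficients_of_finite_relation[OF q(1) I y_eq V \<rho> A])
    show "qpoch_inf (y n * v) q \<noteq> 0" if "v \<in> V" "n \<in> I" for v n
      using nzV that by (auto simp: I_def)
    show "(\<Sum>n. A n * v ^ n) = (\<Sum>n\<in>I. B n / qpoch_inf (y n * v) q)" if "v \<in> V" for v
      unfolding rel[OF that] by (rule suminf_finite[OF I]) (auto simp: I_def)
  qed
  have conv: "summable (\<lambda>j. norm (y n ^ j * cauchy_poly q j v u / qpoch q q j))" if "n \<in> I" for n
  proof (rule summable_dominant[OF q(1) I _ _ y_nz _ coeff summ that])
    show "N \<in> I"
      unfolding N_def using I that by (intro Max_in) auto
    then show "B N \<noteq> 0"
      by (simp add: I_def)
    show "norm (y n) < norm (y N)" if "n \<in> I" "n \<noteq> N" for n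
    proof -
      have "norm q ^ (N - n) < 1"
        using le_N[OF that(1)] that(2) q(1) by (simp add: power_less_one_iff)
      then have "norm (y N) * norm q ^ (N - n) < norm (y N) * 1"
        using y_nz[of N] by (intro mult_strict_left_mono) auto
      then show ?thesis
        by (simp add: y_eq[OF that(1)] norm_mult norm_power)
    qed
  qed
  have "(\<Sum>n. B n * (qpoch_inf (y n * u) q / qpoch_inf (y n * v) q) * Phi a b q (y n * z)) =
      (\<Sum>n\<in>I. B n * (qpoch_inf (y n * u) q / qpoch_inf (y n * v) q) * Phi a b q (y n * z))"
    by (rule suminf_finite[OF I]) (auto simp: I_def)
  moreover have "(\<lambda>n. (-1) ^ n * q ^ (n choose 2) * A n * Psi a b q n u v z) sums
      (\<Sum>n\<in>I. B n * (qpoch_inf (y n * u) q / qpoch_inf (y n * v) q) * Phi a b q (y n * z))"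
    by (rule Psi_generating_function[OF q I coeff conv])
      (use phi nz in \<open>auto simp: I_def\<close>)
  ultimately show ?thesis
    by simp
qed

text \<open>Serves the case x t = 0. A constant right-hand side is a finite relation with a single
  term, indexed by the unit type, whose \<open>y\<close> is 0; as \<open>0 ^ 0 = 1\<close>, this
  means \<open>A 0 = c\<close> and all other coefficients vanish.\<close>

lemma Psi_transfer_constant:
  assumes q: "norm q < 1" "q \<noteq> 0"
    and V: "open V" "V \<noteq> {}" "V \<subseteq> ball 0 \<rho>"
    and \<rho>: "0 < \<rho>" and A: "summable (\<lambda>n. norm (A n) * \<rho> ^ n)"
    and rel: "\<And>v. v \<in> V \<Longrightarrow> (\<Sum>n. A n * v ^ n) = c"
  shows "(\<lambda>n. (-1) ^ n * q ^ (n choose 2) * A n * Psi a b q n u v z) sums c"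
proof -
  have coeff: "A k * qpoch q q k = (\<Sum>n\<in>{()}. c * 0 ^ k)" for k
    by (rule coefficients_of_finite_relation[OF q(1) _ _ V \<rho> A, where Y = 0 and e = "\<lambda>_. 0"])
      (use rel in auto)
  have conv: "summable (\<lambda>j. norm (0 ^ j * cauchy_poly q j v u / qpoch q q j))"
    by (rule summable_finite[of "{0}"]) auto
  show ?thesis
    using Psi_generating_function[OF q _ coeff, of v u a b z] conv summable_Phi_term_0[of a b q]
    by simp
qed

theorem theorem4:
  fixes q x t u v z :: complex
    and a b :: "complex list"
    and A B :: "nat \<Rightarrow> complex"
    and D :: "(complex \<times> complex) set"
  assumes q: "0 < norm q" "norm q < 1"
    and b: "\<forall>c\<in>set b. \<forall>k. qpoch c q k \<noteq> 0"
    and D: "open D" "D \<noteq> {}"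
    and conv1: "\<forall>(u', v')\<in>D. relation_converges q x t A B u' v'"
    and rel1: "\<forall>(u', v')\<in>D.
      (\<Sum>n. A n * cauchy_poly q n v' u') = (\<Sum>n. B n * qratio q x t u' v' n)"
    and uv: "relation_converges q x t A B u v"
    and uvz: "conclusion_converges a b q x t A B u v z"
  shows "(\<Sum>n. (-1) ^ n * q ^ (n choose 2) * A n * Psi a b q n u v z) =
         (\<Sum>n. B n * qratio q x t u v n * Phi a b q (x * z * t * q powi (1 - int n)))"
proof -
  define y where "y n = x * t * q powi (1 - int n)" for n
  have "q \<noteq> 0" using q by auto
  have y: "y (Suc n) * q = y n" for n
    using \<open>q \<noteq> 0\<close> power_int_add_1[of q "- int n"] by (simp add: y_def add.commute)
  have arg: "x * w * t * q powi (1 - int n) = y n * w" for w n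
    by (simp add: y_def mult_ac)
  have ratio: "qratio q x t u' v' n = qpoch_inf (y n * u') q / qpoch_inf (y n * v') q" for u' v' n
    by (simp add: qratio_def arg)
  note conv = conv1[unfolded relation_converges_def ratio arg]
  note uv' = uv[unfolded relation_converges_def ratio arg]
  note uvz' = uvz[unfolded conclusion_converges_def ratio arg]
  obtain V r \<rho> where V: "open V" "V \<noteq> {}" "V \<subseteq> ball 0 \<rho>" and r: "0 < r" and \<rho>: "0 < \<rho>"
    and A: "summable (\<lambda>n. norm (A n) * \<rho> ^ n)"
    and nz: "\<And>v n. v \<in> V \<Longrightarrow> B n \<noteq> 0 \<Longrightarrow> qpoch_inf (y n * v) q \<noteq> 0"
    and rel: "\<And>u v. v \<in> V \<Longrightarrow> norm u < r \<Longrightarrow> (\<Sum>n. A n * cauchy_poly q n v u) =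
      (\<Sum>n. B n * (qpoch_inf (y n * u) q / qpoch_inf (y n * v) q))"
  proof (rule extend_relation[where y = y and q = q and A = A and B = B, OF q(2) \<open>q \<noteq> 0\<close> y D])
    show "(\<Sum>n. A n * cauchy_poly q n v u) =
      (\<Sum>n. B n * (qpoch_inf (y n * u) q / qpoch_inf (y n * v) q))" if "(u, v) \<in> D" for u v
      using rel1 that by (auto simp: ratio)
  qed (use conv in \<open>auto\<close>)
  have rel0: "(\<Sum>n. A n * v ^ n) = (\<Sum>n. B n / qpoch_inf (y n * v) q)" if "v \<in> V" for v
    using rel[OF that, of 0] r by simp
  have "(\<lambda>n. (-1) ^ n * q ^ (n choose 2) * A n * Psi a b q n u v z) sums
    (\<Sum>n. B n * (qpoch_inf (y n * u) q / qpoch_inf (y n * v) q) * Phi a b q (y n * z))"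
  proof (cases "y 0 = 0")
    case True
    \<comment> \<open>All ratios and all values of \<open>Phi\<close> are then 1, so both right-hand
      series reduce to the sum of \<open>B n\<close>.\<close>
    then have "y n = 0" for n
      using geometric_sequence[of y q 0 n, OF y] \<open>q \<noteq> 0\<close> by simp
    then show ?thesis
      using Psi_transfer_constant[OF q(2) \<open>q \<noteq> 0\<close> V \<rho> A, of "\<Sum>n. B n"] rel0 by simp
  next
    case False
    \<comment> \<open>The special points \<open>1 / y (Suc n)\<close> for \<open>u\<close> and
      \<open>1 / y n\<close> for \<open>v\<close> tend to 0, so for large \<open>n\<close> they lie
      within the radii \<open>r\<close> and \<open>\<rho>\<close>.\<close>
    have inv: "1 / y n = q ^ n / y 0" for n
    proof -
      have "y n * q ^ n = y 0"
        using geometric_sequence[of y q 0 n, OF y] by simp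
      moreover from this have "y n \<noteq> 0"
        using False by auto
      ultimately show ?thesis
        using False by (simp add: frac_eq_eq mult.commute)
    qed
    have "(\<lambda>n. 1 / y n) \<longlonglongrightarrow> 0"
      unfolding inv by (intro tendsto_divide_zero LIMSEQ_power_zero q)
    then have lim: "(\<lambda>n. norm (1 / y n)) \<longlonglongrightarrow> 0"
      by (rule tendsto_norm_zero)
    then have "\<forall>\<^sub>F n in sequentially. norm (1 / y n) < \<rho>"
      using \<rho> by (rule order_tendstoD)
    moreover have "\<forall>\<^sub>F n in sequentially. norm (1 / y (Suc n)) < r"
      using order_tendstoD(2)[OF LIMSEQ_Suc[OF lim] r] .
    ultimately have "\<forall>\<^sub>F n in sequentially. B n = 0"
    proof eventually_elim
      case (elim n)
      show ?case
        by (rule relation_coefficient_eq_0[where y = y and q = q, OF q(2) \<open>q \<noteq> 0\<close> y False V \<rho> A nz rel])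
          (use elim in auto)
    qed
    then have "finite {n. B n \<noteq> 0}"
      using eventually_cofinite[of "\<lambda>n. B n = 0"] by (simp add: cofinite_eq_sequentially)
    \<comment> \<open>The point \<open>(u, v)\<close> may lie outside \<open>D\<close>;
      \<open>uv\<close> and \<open>uvz\<close> supply what is asked of it.\<close>
    then show ?thesis
      using uv' uvz' by (intro Psi_transfer_finite[where y = y and q = q, OF q(2) \<open>q \<noteq> 0\<close> y False _ V \<rho> A nz rel0]) auto
  qed
  then show ?thesis
    unfolding ratio arg by (rule sums_unique[symmetric])
qed

end
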